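(* Let $p$ be a constant with $0<p<1$, put $q=1-p$, and let $G\in\mathcal{G}(n,p)$. Then with probability tending to $1$ as $n\to\infty$, $$D_0(G)\le (2+o(1))\,\frac{\ln n}{-\ln(p^2+q^2)}.$$
   Context: Graphs are finite and simple. First order sentences about graphs are built from variables (ranging over vertices), the relations $=$ and $\sim$ (adjacency), the quantifiers $\forall,\exists$ and the Boolean connectives. The quantifier depth of a sentence is the maximum number of nested quantifiers. A sentence $A$ defines $G$ if $G\models A$ and $H\not\models A$ for every graph $H\not\cong G$. For a sentence in which no quantifier lies within the scope of a negation, its alternation number is the maximum, over chains of nested quantifiers, of the number of changes between $\exists$ and $\forall$ along the chain. $D_r(G)$ is the minimum quantifier depth of a sentence with alternation number at most $r$ that defines $G$. $\mathcal{G}(n,p)$ is the random graph on $\{1,\dots,n\}$ with each edge present independently with probability $p$. *)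

theory Defs
  imports "HOL-Probability.Probability"
begin

text \<open>A graph is a pair of a vertex set and a set of edges, an edge being a two-element
  set of vertices.\<close>

type_synonym 'a graph = "'a set \<times> 'a set set"

definition pairs_of :: "'a set \<Rightarrow> 'a set set" where
  "pairs_of V = {e. e \<subseteq> V \<and> card e = 2}"

definition simple_graph :: "'a graph \<Rightarrow> bool" where
  "simple_graph G \<longleftrightarrow> finite (fst G) \<and> snd G \<subseteq> pairs_of (fst G)"

definition adjacent :: "'a graph \<Rightarrow> 'a \<Rightarrow> 'a \<Rightarrow> bool" where
  "adjacent G u v \<longleftrightarrow> {u, v} \<in> snd G"

definition graph_iso :: "'a graph \<Rightarrow> 'b graph \<Rightarrow> bool" where
  "graph_iso G H \<longleftrightarrow>
     (\<exists>f. bij_betw f (fst G) (fst H) \<and>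
          (\<forall>u\<in>fst G. \<forall>v\<in>fst G. adjacent G u v \<longleftrightarrow> adjacent H (f u) (f v)))"

datatype fo =
    EqF nat nat
  | AdjF nat nat
  | NegF fo
  | ConjF fo fo
  | DisjF fo fo
  | ExF nat fo
  | AllF nat fo

primrec free_vars :: "fo \<Rightarrow> nat set" where
  "free_vars (EqF i j) = {i, j}"
| "free_vars (AdjF i j) = {i, j}"
| "free_vars (NegF A) = free_vars A"
| "free_vars (ConjF A B) = free_vars A \<union> free_vars B"
| "free_vars (DisjF A B) = free_vars A \<union> free_vars B"
| "free_vars (ExF i A) = free_vars A - {i}"
| "free_vars (AllF i A) = free_vars A - {i}"

definition sentence :: "fo \<Rightarrow> bool" where
  "sentence A \<longleftrightarrow> free_vars A = {}"

primrec sat :: "'a graph \<Rightarrow> (nat \<Rightarrow> 'a) \<Rightarrow> fo \<Rightarrow> bool" where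
  "sat G \<sigma> (EqF i j) \<longleftrightarrow> \<sigma> i = \<sigma> j"
| "sat G \<sigma> (AdjF i j) \<longleftrightarrow> adjacent G (\<sigma> i) (\<sigma> j)"
| "sat G \<sigma> (NegF A) \<longleftrightarrow> \<not> sat G \<sigma> A"
| "sat G \<sigma> (ConjF A B) \<longleftrightarrow> sat G \<sigma> A \<and> sat G \<sigma> B"
| "sat G \<sigma> (DisjF A B) \<longleftrightarrow> sat G \<sigma> A \<or> sat G \<sigma> B"
| "sat G \<sigma> (ExF i A) \<longleftrightarrow> (\<exists>v\<in>fst G. sat G (\<sigma>(i := v)) A)"
| "sat G \<sigma> (AllF i A) \<longleftrightarrow> (\<forall>v\<in>fst G. sat G (\<sigma>(i := v)) A)"

text \<open>Only meant for sentences, whose truth value does not depend on the assignment.\<close>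

definition models :: "'a graph \<Rightarrow> fo \<Rightarrow> bool" where
  "models G A \<longleftrightarrow> (\<forall>\<sigma>. sat G \<sigma> A)"

text \<open>Every finite graph is isomorphic to one with vertices in \<^typ>\<open>nat\<close>, so it
  suffices to let \<open>H\<close> range over graphs on natural numbers.\<close>

definition defines_graph :: "fo \<Rightarrow> 'a graph \<Rightarrow> bool" where
  "defines_graph A G \<longleftrightarrow>
     models G A \<and>
     (\<forall>H :: nat graph. simple_graph H \<and> \<not> graph_iso H G \<longrightarrow> \<not> models H A)"

primrec quantifier_depth :: "fo \<Rightarrow> nat" where
  "quantifier_depth (EqF i j) = 0"
| "quantifier_depth (AdjF i j) = 0"
| "quantifier_depth (NegF A) = quantifier_depth A"
| "quantifier_depth (ConjF A B) = max (quantifier_depth A) (quantifier_depth B)"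
| "quantifier_depth (DisjF A B) = max (quantifier_depth A) (quantifier_depth B)"
| "quantifier_depth (ExF i A) = Suc (quantifier_depth A)"
| "quantifier_depth (AllF i A) = Suc (quantifier_depth A)"

text \<open>No quantifier lies within the scope of a negation.\<close>

primrec negation_inside :: "fo \<Rightarrow> bool" where
  "negation_inside (EqF i j) \<longleftrightarrow> True"
| "negation_inside (AdjF i j) \<longleftrightarrow> True"
| "negation_inside (NegF A) \<longleftrightarrow> quantifier_depth A = 0"
| "negation_inside (ConjF A B) \<longleftrightarrow> negation_inside A \<and> negation_inside B"
| "negation_inside (DisjF A B) \<longleftrightarrow> negation_inside A \<and> negation_inside B"
| "negation_inside (ExF i A) \<longleftrightarrow> negation_inside A"
| "negation_inside (AllF i A) \<longleftrightarrow> negation_inside A"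

datatype quantifier = Exists | Forall

text \<open>The sequences of quantifiers met on the paths from the root to the leaves of the
  syntax tree; shorter chains of nested quantifiers are subsequences of these and have no
  more changes.\<close>

primrec quantifier_chains :: "fo \<Rightarrow> quantifier list set" where
  "quantifier_chains (EqF i j) = {[]}"
| "quantifier_chains (AdjF i j) = {[]}"
| "quantifier_chains (NegF A) = quantifier_chains A"
| "quantifier_chains (ConjF A B) = quantifier_chains A \<union> quantifier_chains B"
| "quantifier_chains (DisjF A B) = quantifier_chains A \<union> quantifier_chains B"
| "quantifier_chains (ExF i A) = (\<lambda>qs. Exists # qs) ` quantifier_chains A"
| "quantifier_chains (AllF i A) = (\<lambda>qs. Forall # qs) ` quantifier_chains A"

definition changes :: "'b list \<Rightarrow> nat" where
  "changes qs = card {i. Suc i < length qs \<and> qs ! i \<noteq> qs ! Suc i}"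

definition alternation_number :: "fo \<Rightarrow> nat" where
  "alternation_number A = Max (changes ` quantifier_chains A)"

text \<open>Valued in \<^typ>\<open>enat\<close> so that an empty set of defining sentences would give
  infinity and not \<open>0\<close>.\<close>

definition D :: "nat \<Rightarrow> 'a graph \<Rightarrow> enat" where
  "D r G = Inf {enat (quantifier_depth A) | A.
     sentence A \<and> negation_inside A \<and> alternation_number A \<le> r \<and> defines_graph A G}"

definition random_graph :: "nat \<Rightarrow> real \<Rightarrow> nat graph pmf" where
  "random_graph n p =
     map_pmf (\<lambda>b. ({1..n}, {e \<in> pairs_of {1..n}. b e}))
       (Pi_pmf (pairs_of {1..n}) False (\<lambda>_. bernoulli_pmf p))"

end

theory Submission
  imports Defs "HOL-Real_Asymp.Real_Asymp"
begin

text \<open>Let \<open>X = {1..k}\<close> with \<open>k\<close> slightly larger than \<open>2 ln n / - ln (p\<^sup>2 + q\<^sup>2)\<close>. With high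
  probability any two vertices outside \<open>X\<close> have different neighbourhoods in \<open>X\<close>, and the
  identity is the only embedding of \<open>G[X]\<close> as an induced subgraph of \<open>G\<close>. Such a \<open>G\<close> is defined
  by the conjunction of two sentences: one says that some copy of \<open>X\<close> has, for every
  vertex \<open>u\<close> of \<open>G\<close>, a vertex related to the copy as \<open>u\<close> is to \<open>X\<close>; the other says that any two
  vertices together with any copy of \<open>X\<close> look like some two vertices of \<open>G\<close> together with \<open>X\<close>.
  The first is purely existential. The second is purely universal, and it holds in \<open>G\<close>
  because \<open>X\<close> is the only copy of itself.

  A non-identical \<open>f\<close> embeds \<open>G[X]\<close> only if the edge indicators agree on each pair and its
  image. Linking every pair to its image splits the pairs moved by \<open>f\<close> and their images into
  blocks of size \<open>c \<ge> 2\<close> on which the indicators are constant, which has probability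
  \<open>p\<^sup>c + q\<^sup>c \<le> (p\<^sup>2 + q\<^sup>2) powr (c / 2)\<close>.\<close>

subsection \<open>A defining sentence without alternation\<close>

definition conjs :: "fo list \<Rightarrow> fo" where
  "conjs As = foldr ConjF As (EqF 0 0)"

text \<open>\<open>EqF 0 0\<close> and its negation serve as truth and falsity in
  \<open>conjs\<close> and \<open>disjs\<close>. They make variable 0 free even over an empty list,
  so an outer block has to bind it.\<close>

definition disjs :: "fo list \<Rightarrow> fo" where
  "disjs As = foldr DisjF As (NegF (EqF 0 0))"

definition lit :: "bool \<Rightarrow> fo \<Rightarrow> fo" where
  "lit c A = (if c then A else NegF A)"

text \<open>Each step adds the new quantifier innermost, so variable 0 is bound outermost.\<close>

primrec exs :: "nat \<Rightarrow> fo \<Rightarrow> fo" where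
  "exs 0 A = A"
| "exs (Suc m) A = exs m (ExF m A)"

primrec alls :: "nat \<Rightarrow> fo \<Rightarrow> fo" where
  "alls 0 A = A"
| "alls (Suc m) A = alls m (AllF m A)"

definition diagram :: "'a graph \<Rightarrow> nat \<Rightarrow> (nat \<Rightarrow> 'a) \<Rightarrow> fo" where
  "diagram G m v = conjs (concat (map (\<lambda>i. concat (map (\<lambda>j.
     [lit (v i = v j) (EqF i j), lit (adjacent G (v i) (v j)) (AdjF i j)]) [0..<m])) [0..<m]))"

text \<open>Semantic counterpart of \<open>diagram\<close>: sending \<open>v i\<close> to
  \<open>w i\<close> for \<open>i < m\<close> is a well-defined partial isomorphism.\<close>

definition same_diagram :: "nat \<Rightarrow> 'a graph \<Rightarrow> (nat \<Rightarrow> 'a) \<Rightarrow> 'b graph \<Rightarrow> (nat \<Rightarrow> 'b) \<Rightarrow> bool" where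
  "same_diagram m G v H w \<longleftrightarrow> (\<forall>i<m. \<forall>j<m.
     (w i = w j \<longleftrightarrow> v i = v j) \<and> (adjacent H (w i) (w j) \<longleftrightarrow> adjacent G (v i) (v j)))"

lemma sat_conjs [simp]: "sat G \<sigma> (conjs As) \<longleftrightarrow> (\<forall>A\<in>set As. sat G \<sigma> A)"
  unfolding conjs_def by (induction As) auto

lemma sat_disjs [simp]: "sat G \<sigma> (disjs As) \<longleftrightarrow> (\<exists>A\<in>set As. sat G \<sigma> A)"
  unfolding disjs_def by (induction As) auto

lemma free_vars_conjs [simp]: "free_vars (conjs As) = insert 0 (\<Union>A\<in>set As. free_vars A)"
  unfolding conjs_def by (induction As) auto

lemma free_vars_disjs [simp]: "free_vars (disjs As) = insert 0 (\<Union>A\<in>set As. free_vars A)"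
  unfolding disjs_def by (induction As) auto

lemma negation_inside_conjs [simp]: "negation_inside (conjs As) \<longleftrightarrow> (\<forall>A\<in>set As. negation_inside A)"
  unfolding conjs_def by (induction As) auto

lemma negation_inside_disjs [simp]: "negation_inside (disjs As) \<longleftrightarrow> (\<forall>A\<in>set As. negation_inside A)"
  unfolding disjs_def by (induction As) auto

lemma quantifier_depth_conjs_le:
  "(\<And>A. A \<in> set As \<Longrightarrow> quantifier_depth A \<le> d) \<Longrightarrow> quantifier_depth (conjs As) \<le> d"
  unfolding conjs_def by (induction As) auto

lemma quantifier_depth_disjs_le:
  "(\<And>A. A \<in> set As \<Longrightarrow> quantifier_depth A \<le> d) \<Longrightarrow> quantifier_depth (disjs As) \<le> d"
  unfolding disjs_def by (induction As) auto

lemma quantifier_chains_conjs [simp]: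
  "quantifier_chains (conjs As) = insert [] (\<Union>A\<in>set As. quantifier_chains A)"
  unfolding conjs_def by (induction As) auto

lemma quantifier_chains_depth_0: "quantifier_depth A = 0 \<Longrightarrow> quantifier_chains A = {[]}"
  by (induction A) auto

lemma negation_inside_depth_0: "quantifier_depth A = 0 \<Longrightarrow> negation_inside A"
  by (induction A) auto

lemma quantifier_depth_lit [simp]: "quantifier_depth (lit c A) = quantifier_depth A"
  by (simp add: lit_def)

lemma free_vars_lit [simp]: "free_vars (lit c A) = free_vars A"
  by (simp add: lit_def)

lemma sat_lit [simp]: "sat G \<sigma> (lit c A) \<longleftrightarrow> (sat G \<sigma> A \<longleftrightarrow> c)"
  by (auto simp add: lit_def)

lemma quantifier_depth_diagram [simp]: "quantifier_depth (diagram G m v) = 0"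
proof -
  have "quantifier_depth (diagram G m v) \<le> 0"
    unfolding diagram_def by (rule quantifier_depth_conjs_le) auto
  then show ?thesis by simp
qed

lemma free_vars_diagram: "free_vars (diagram G m v) \<subseteq> insert 0 {..<m}"
  by (auto simp: diagram_def)

lemma sat_diagram [simp]: "sat H \<sigma> (diagram G m v) \<longleftrightarrow> same_diagram m G v H \<sigma>"
  by (fastforce simp: diagram_def same_diagram_def)

lemma free_vars_exs [simp]: "free_vars (exs m A) = free_vars A - {..<m}"
  by (induction m arbitrary: A) auto

lemma free_vars_alls [simp]: "free_vars (alls m A) = free_vars A - {..<m}"
  by (induction m arbitrary: A) auto

lemma negation_inside_exs [simp]: "negation_inside (exs m A) \<longleftrightarrow> negation_inside A"
  by (induction m arbitrary: A) auto

lemma negation_inside_alls [simp]: "negation_inside (alls m A) \<longleftrightarrow> negation_inside A"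
  by (induction m arbitrary: A) auto

lemma quantifier_depth_exs [simp]: "quantifier_depth (exs m A) = m + quantifier_depth A"
  by (induction m arbitrary: A) auto

lemma quantifier_depth_alls [simp]: "quantifier_depth (alls m A) = m + quantifier_depth A"
  by (induction m arbitrary: A) auto

lemma quantifier_chains_exs:
  "quantifier_chains (exs m A) = (\<lambda>qs. replicate m Exists @ qs) ` quantifier_chains A"
  by (induction m arbitrary: A) (auto simp: replicate_app_Cons_same image_image)

lemma quantifier_chains_alls:
  "quantifier_chains (alls m A) = (\<lambda>qs. replicate m Forall @ qs) ` quantifier_chains A"
  by (induction m arbitrary: A) (auto simp: replicate_app_Cons_same image_image)

lemma changes_replicate [simp]: "changes (replicate m x) = 0"
proof -
  have "{i. Suc i < length (replicate m x) \<and> replicate m x ! i \<noteq> replicate m x ! Suc i} = {}"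
    by auto
  then show ?thesis unfolding changes_def by (simp only: card.empty)
qed

lemma sat_exs:
  "sat G \<sigma> (exs m A) \<longleftrightarrow>
     (\<exists>\<tau>. (\<forall>i<m. \<tau> i \<in> fst G) \<and> (\<forall>i\<ge>m. \<tau> i = \<sigma> i) \<and> sat G \<tau> A)"
proof (induction m arbitrary: A)
  case 0
  have "\<tau> = \<sigma>" if "\<forall>i\<ge>0. \<tau> i = \<sigma> i" for \<tau> using that by auto
  then show ?case by auto
next
  case (Suc m)
  show ?case
  proof
    assume "sat G \<sigma> (exs (Suc m) A)"
    then obtain \<tau> v where "\<forall>i<m. \<tau> i \<in> fst G" "\<forall>i\<ge>m. \<tau> i = \<sigma> i" "v \<in> fst G" "sat G (\<tau>(m := v)) A"
      unfolding exs.simps Suc.IH by auto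
    then show "\<exists>\<tau>. (\<forall>i<Suc m. \<tau> i \<in> fst G) \<and> (\<forall>i\<ge>Suc m. \<tau> i = \<sigma> i) \<and> sat G \<tau> A"
      by (intro exI[of _ "\<tau>(m := v)"]) (auto simp: less_Suc_eq)
  next
    assume "\<exists>\<tau>. (\<forall>i<Suc m. \<tau> i \<in> fst G) \<and> (\<forall>i\<ge>Suc m. \<tau> i = \<sigma> i) \<and> sat G \<tau> A"
    then obtain \<tau> where "\<forall>i<Suc m. \<tau> i \<in> fst G" "\<forall>i\<ge>Suc m. \<tau> i = \<sigma> i" "sat G \<tau> A"
      by blast
    \<comment> \<open>The induction hypothesis speaks of assignments agreeing with
      \<open>\<sigma>\<close> at \<open>m\<close>, so the value there is reset and supplied as the
      witness of the inner quantifier instead.\<close>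
    then have "(\<forall>i<m. (\<tau>(m := \<sigma> m)) i \<in> fst G) \<and> (\<forall>i\<ge>m. (\<tau>(m := \<sigma> m)) i = \<sigma> i) \<and>
        sat G (\<tau>(m := \<sigma> m)) (ExF m A)"
      by (auto intro!: bexI[of _ "\<tau> m"])
    then show "sat G \<sigma> (exs (Suc m) A)"
      unfolding exs.simps Suc.IH by blast
  qed
qed

lemma sat_alls:
  "sat G \<sigma> (alls m A) \<longleftrightarrow>
     (\<forall>\<tau>. (\<forall>i<m. \<tau> i \<in> fst G) \<longrightarrow> (\<forall>i\<ge>m. \<tau> i = \<sigma> i) \<longrightarrow> sat G \<tau> A)"
proof -
  \<comment> \<open>A general \<open>B\<close> lets the induction run: once quantifiers enter the
    matrices, these are complementary in truth value but no longer literal negations.\<close>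
  have dual: "sat G \<sigma> (alls m A) \<longleftrightarrow> \<not> sat G \<sigma> (exs m B)" if "\<And>\<tau>. sat G \<tau> B \<longleftrightarrow> \<not> sat G \<tau> A" for B
    using that by (induction m arbitrary: A B) auto
  show ?thesis
    using dual[of "NegF A"] sat_exs[of G \<sigma> m "NegF A"] by auto
qed

section \<open>The defining sentence and its correctness\<close>

definition existential_part :: "'a graph \<Rightarrow> nat \<Rightarrow> (nat \<Rightarrow> 'a) \<Rightarrow> 'a list \<Rightarrow> fo" where
  "existential_part G k v us =
     exs k (conjs (map (\<lambda>u. ExF k (diagram G (k + 1) (v(k := u)))) us))"

text \<open>An implication from the diagram of \<open>v\<close>, written as a disjunction so that
  the negation covers only a quantifier-free formula. The length of \<open>us\<close> does not
  affect the depth of either part; the existential one reuses variable \<open>k\<close> in every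
  conjunct.\<close>

definition universal_part :: "'a graph \<Rightarrow> nat \<Rightarrow> (nat \<Rightarrow> 'a) \<Rightarrow> 'a list \<Rightarrow> fo" where
  "universal_part G k v us =
     alls (k + 2) (DisjF (NegF (diagram G k v))
       (disjs (map (\<lambda>(u, w). diagram G (k + 2) (v(k := u, k + 1 := w))) (List.product us us))))"

lemma same_diagram_cong:
  assumes "\<And>i. i < m \<Longrightarrow> v i = v' i" "\<And>i. i < m \<Longrightarrow> w i = w' i"
  shows "same_diagram m G v H w \<longleftrightarrow> same_diagram m G v' H w'"
  unfolding same_diagram_def using assms by auto

lemma same_diagram_mono: "same_diagram m G v H w \<Longrightarrow> m' \<le> m \<Longrightarrow> same_diagram m' G v H w"
  unfolding same_diagram_def by auto

lemma same_diagram_refl: "same_diagram m G v G v"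
  unfolding same_diagram_def by auto

text \<open>By \<open>unique\<close> every copy of \<open>v\<close> in \<open>G\<close> is
  \<open>v\<close> itself, so any pair of vertices serves as its own pattern and the universal part
  holds in \<open>G\<close>. In a model \<open>H\<close>, fix the copy given by the existential
  part. Every vertex of \<open>H\<close> fits some vertex of \<open>G\<close> by the universal part
  and only one by \<open>sieve\<close>, and every vertex of \<open>G\<close> is reached by the
  existential part. Applied to pairs, the universal part makes this map injective and compatible
  with adjacency.\<close>

lemma defines_graph_parts:
  fixes G :: "'a graph"
  assumes us: "set us = fst G" and ne: "fst G \<noteq> {}"
    and v: "\<And>i. i < k \<Longrightarrow> v i \<in> fst G"
    and unique: "\<And>\<tau> i. \<lbrakk>\<And>i. i < k \<Longrightarrow> \<tau> i \<in> fst G; same_diagram k G v G \<tau>; i < k\<rbrakk> \<Longrightarrow> \<tau> i = v i"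
    and sieve: "\<And>u w. \<lbrakk>u \<in> fst G; w \<in> fst G;
        \<And>i. i < k \<Longrightarrow> (u = v i \<longleftrightarrow> w = v i) \<and> (adjacent G u (v i) \<longleftrightarrow> adjacent G w (v i))\<rbrakk> \<Longrightarrow> u = w"
  shows "defines_graph (ConjF (existential_part G k v us) (universal_part G k v us)) G"
  unfolding defines_graph_def
proof (intro conjI allI impI)
  show "models G (ConjF (existential_part G k v us) (universal_part G k v us))"
    unfolding models_def
  proof
    fix \<sigma> :: "nat \<Rightarrow> 'a"
    have "\<exists>\<tau>. (\<forall>i<k. \<tau> i \<in> fst G) \<and> (\<forall>i\<ge>k. \<tau> i = \<sigma> i) \<and>
        (\<forall>u\<in>fst G. \<exists>x\<in>fst G. same_diagram (k + 1) G (v(k := u)) G (\<tau>(k := x)))"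
    proof (intro exI conjI ballI)
      fix u assume "u \<in> fst G"
      moreover have "same_diagram (k + 1) G (v(k := u)) G ((\<lambda>i. if i < k then v i else \<sigma> i)(k := u))
          \<longleftrightarrow> same_diagram (k + 1) G (v(k := u)) G (v(k := u))"
        by (rule same_diagram_cong) auto
      ultimately show "\<exists>x\<in>fst G. same_diagram (k + 1) G (v(k := u)) G ((\<lambda>i. if i < k then v i else \<sigma> i)(k := x))"
        using same_diagram_refl by blast
    qed (use v in auto)
    then have 1: "sat G \<sigma> (existential_part G k v us)"
      by (simp add: existential_part_def sat_exs us)
    have 2: "sat G \<sigma> (universal_part G k v us)"
      unfolding universal_part_def sat_alls
    proof (intro allI impI)
      fix \<tau> assume \<tau>: "\<forall>i<k + 2. \<tau> i \<in> fst G"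
      have "same_diagram (k + 2) G (v(k := \<tau> k, k + 1 := \<tau> (k + 1))) G \<tau>" if "same_diagram k G v G \<tau>"
      proof -
        have eq: "\<tau> i = v i" if "i < k" for i
          using unique[of \<tau> i] \<tau> that \<open>same_diagram k G v G \<tau>\<close> by simp
        have "same_diagram (k + 2) G (v(k := \<tau> k, k + 1 := \<tau> (k + 1))) G \<tau> \<longleftrightarrow>
            same_diagram (k + 2) G \<tau> G \<tau>"
        proof (rule same_diagram_cong)
          fix i assume "i < k + 2"
          then have "i < k \<or> i = k \<or> i = k + 1" by linarith
          then show "(v(k := \<tau> k, k + 1 := \<tau> (k + 1))) i = \<tau> i"
            using eq by auto
        qed auto
        then show ?thesis by (simp add: same_diagram_refl)
      qed
      moreover have "\<tau> k \<in> fst G" "\<tau> (k + 1) \<in> fst G" using \<tau> by auto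
      ultimately show "sat G \<tau> (DisjF (NegF (diagram G k v))
       (disjs (map (\<lambda>(u, w). diagram G (k + 2) (v(k := u, k + 1 := w))) (List.product us us))))"
        by (auto simp: us)
    qed
    show "sat G \<sigma> (ConjF (existential_part G k v us) (universal_part G k v us))"
      using 1 2 by simp
  qed
next
  fix H :: "nat graph"
  assume H: "simple_graph H \<and> \<not> graph_iso H G"
  show "\<not> models H (ConjF (existential_part G k v us) (universal_part G k v us))"
  proof
    assume "models H (ConjF (existential_part G k v us) (universal_part G k v us))"
    then have ex: "sat H (\<lambda>_. 0) (existential_part G k v us)"
      and all: "\<And>\<sigma>. sat H \<sigma> (universal_part G k v us)"
      by (auto simp: models_def)
    from ex obtain \<tau> where \<tau>: "\<And>i. i < k \<Longrightarrow> \<tau> i \<in> fst H"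
      and wit: "\<And>u. u \<in> fst G \<Longrightarrow> \<exists>x\<in>fst H. same_diagram (k + 1) G (v(k := u)) H (\<tau>(k := x))"
      unfolding existential_part_def sat_exs by (simp add: us) blast
    from wit obtain g where g: "\<And>u. u \<in> fst G \<Longrightarrow> g u \<in> fst H"
      "\<And>u. u \<in> fst G \<Longrightarrow> same_diagram (k + 1) G (v(k := u)) H (\<tau>(k := g u))"
      by metis
    define fits where "fits u x \<longleftrightarrow> (\<forall>i<k. (x = \<tau> i \<longleftrightarrow> u = v i) \<and> (adjacent H x (\<tau> i) \<longleftrightarrow> adjacent G u (v i)))"
      for u x
    have fits_unique: "u = w" if "fits u x" "fits w x" "u \<in> fst G" "w \<in> fst G" for u w x
      using sieve[of u w] that unfolding fits_def by blast
    have fits_g: "fits u (g u)" if "u \<in> fst G" for u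
      unfolding fits_def
    proof (intro allI impI)
      fix i assume "i < k"
      then show "(g u = \<tau> i \<longleftrightarrow> u = v i) \<and> (adjacent H (g u) (\<tau> i) \<longleftrightarrow> adjacent G u (v i))"
        using g(2)[OF that, unfolded same_diagram_def, rule_format, of k i] by simp
    qed
    \<comment> \<open>Any vertex will do: forgetting the last coordinate leaves the diagram of the
      copy alone.\<close>
    from ne g(2) obtain u0 where "same_diagram (k + 1) G (v(k := u0)) H (\<tau>(k := g u0))"
      by blast
    then have "same_diagram k G (v(k := u0)) H (\<tau>(k := g u0))"
      by (rule same_diagram_mono) simp
    moreover have "same_diagram k G (v(k := u0)) H (\<tau>(k := g u0)) \<longleftrightarrow> same_diagram k G v H \<tau>"
      by (rule same_diagram_cong) auto
    ultimately have \<tau>_diag: "same_diagram k G v H \<tau>"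
      by simp
    have pair: "\<exists>u\<in>fst G. \<exists>w\<in>fst G. fits u x \<and> fits w y \<and> (x = y \<longleftrightarrow> u = w) \<and> (adjacent H x y \<longleftrightarrow> adjacent G u w)"
      if xy: "x \<in> fst H" "y \<in> fst H" for x y
    proof -
      define \<rho> where "\<rho> = \<tau>(k := x, k + 1 := y)"
      have \<rho>: "\<rho> i \<in> fst H" if "i < k + 2" for i
      proof -
        have "i < k \<or> i = k \<or> i = k + 1" using that by linarith
        then show ?thesis using xy \<tau> by (auto simp: \<rho>_def)
      qed
      have "same_diagram k G v H \<rho> \<longleftrightarrow> same_diagram k G v H \<tau>"
        by (rule same_diagram_cong) (auto simp: \<rho>_def)
      \<comment> \<open>Evaluating at \<open>\<rho>\<close> itself makes the condition on variables
        beyond the block trivial.\<close>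
      then have "\<exists>u\<in>fst G. \<exists>w\<in>fst G. same_diagram (k + 2) G (v(k := u, k + 1 := w)) H \<rho>"
        using all[of \<rho>, unfolded universal_part_def sat_alls, rule_format, of \<rho>] \<rho> \<tau>_diag
        by (auto simp: us)
      then obtain u w where uw: "u \<in> fst G" "w \<in> fst G"
        and sd: "same_diagram (k + 2) G (v(k := u, k + 1 := w)) H \<rho>"
        by blast
      note sd' = sd[unfolded same_diagram_def \<rho>_def, rule_format]
      have "fits u x \<and> fits w y"
        unfolding fits_def
      proof (intro conjI allI impI)
        fix i assume "i < k"
        then show "x = \<tau> i \<longleftrightarrow> u = v i" "adjacent H x (\<tau> i) \<longleftrightarrow> adjacent G u (v i)"
          "y = \<tau> i \<longleftrightarrow> w = v i" "adjacent H y (\<tau> i) \<longleftrightarrow> adjacent G w (v i)"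
          using sd'[of k i] sd'[of "k + 1" i] by simp_all
      qed
      moreover have "(x = y \<longleftrightarrow> u = w) \<and> (adjacent H x y \<longleftrightarrow> adjacent G u w)"
        using sd'[of k "k + 1"] by simp
      ultimately show ?thesis using uw by blast
    qed
    \<comment> \<open>The vertices supplied by \<open>pair\<close> are \<open>u\<close> and
      \<open>w\<close>, because fitting determines the vertex of \<open>G\<close>.\<close>
    have hom: "(x = y \<longleftrightarrow> u = w) \<and> (adjacent H x y \<longleftrightarrow> adjacent G u w)"
      if "x \<in> fst H" "y \<in> fst H" "u \<in> fst G" "w \<in> fst G" "fits u x" "fits w y" for x y u w
      using pair[OF that(1,2)] fits_unique that by metis
    obtain h where h: "\<And>x. x \<in> fst H \<Longrightarrow> h x \<in> fst G \<and> fits (h x) x"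
      using pair by metis
    have "bij_betw h (fst H) (fst G)"
    proof (rule bij_betwI')
      fix x y assume "x \<in> fst H" "y \<in> fst H"
      then show "(h x = h y) = (x = y)"
        using hom[of x y "h x" "h y"] h[of x] h[of y] by simp
    next
      fix u assume "u \<in> fst G"
      then show "\<exists>x\<in>fst H. u = h x"
        using g(1)[of u] fits_g[of u] h[of "g u"] fits_unique[of u "g u" "h (g u)"] by blast
    qed (use h in blast)
    moreover have "adjacent H x y \<longleftrightarrow> adjacent G (h x) (h y)" if "x \<in> fst H" "y \<in> fst H" for x y
      using hom[of x y "h x" "h y"] h[of x] h[of y] that by simp
    ultimately have "graph_iso H G" unfolding graph_iso_def by blast
    with H show False by simp
  qed
qed

lemma D_0_le:
  fixes G :: "'a graph"
  assumes fin: "finite (fst G)" and k: "0 < k"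
    and v: "\<And>i. i < k \<Longrightarrow> v i \<in> fst G"
    and unique: "\<And>\<tau> i. \<lbrakk>\<And>i. i < k \<Longrightarrow> \<tau> i \<in> fst G; same_diagram k G v G \<tau>; i < k\<rbrakk> \<Longrightarrow> \<tau> i = v i"
    and sieve: "\<And>u w. \<lbrakk>u \<in> fst G; w \<in> fst G;
        \<And>i. i < k \<Longrightarrow> (u = v i \<longleftrightarrow> w = v i) \<and> (adjacent G u (v i) \<longleftrightarrow> adjacent G w (v i))\<rbrakk> \<Longrightarrow> u = w"
  shows "D 0 G \<le> enat (k + 2)"
proof -
  obtain us where us: "set us = fst G" using finite_list[OF fin] by blast
  have ne: "fst G \<noteq> {}" using v[OF k] by blast
  let ?E = "existential_part G k v us" and ?U = "universal_part G k v us"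
  let ?A = "ConjF ?E ?U"
  have "us \<noteq> []" using ne us by auto
  have depth_disjs: "quantifier_depth (disjs (map (\<lambda>(u, w). diagram G (k + 2) (v(k := u, k + 1 := w)))
      (List.product us us))) = 0" (is "quantifier_depth ?B = 0")
  proof -
    have "quantifier_depth ?B \<le> 0" by (rule quantifier_depth_disjs_le) auto
    then show ?thesis by simp
  qed
  have depth_conjs: "quantifier_depth (conjs (map (\<lambda>u. ExF k (diagram G (k + 1) (v(k := u)))) us)) \<le> 1"
    by (rule quantifier_depth_conjs_le) auto
  have depth: "quantifier_depth ?A = k + 2"
    using depth_conjs depth_disjs by (simp add: existential_part_def universal_part_def)
  \<comment> \<open>The variable 0 left free by \<open>conjs\<close> is bound by the block
    \<open>exs k\<close> because \<open>0 < k\<close>.\<close>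
  have "free_vars ?E = {}" "free_vars ?U = {}"
    using free_vars_diagram[of G "k + 1"] free_vars_diagram[of G k v] free_vars_diagram[of G "k + 2"] k
    by (fastforce simp: existential_part_def universal_part_def)+
  then have sent: "sentence ?A" by (simp add: sentence_def)
  have neg: "negation_inside ?A"
    by (auto simp: existential_part_def universal_part_def negation_inside_depth_0)
  \<comment> \<open>The shorter chain comes from the leaf \<open>EqF 0 0\<close> that closes the
    conjunction.\<close>
  have chE: "quantifier_chains ?E \<subseteq> {replicate k Exists, replicate (k + 1) Exists}"
    by (auto simp: existential_part_def quantifier_chains_exs quantifier_chains_depth_0
        replicate_append_same)
  have chU: "quantifier_chains ?U = {replicate (k + 2) Forall}"
    using depth_disjs
    by (auto simp: universal_part_def quantifier_chains_alls quantifier_chains_depth_0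
        replicate_app_Cons_same)
  \<comment> \<open>A conjunction unites the chains of its sides, so the existential and universal
    blocks never meet in one chain. Nonemptiness gives \<open>Max\<close> its value.\<close>
  have "changes ` quantifier_chains ?A = {0}"
  proof -
    have "changes qs = 0" if "qs \<in> quantifier_chains ?A" for qs
      using that chE chU changes_replicate by (auto simp del: replicate.simps replicate_Suc)
    moreover have "quantifier_chains ?A \<noteq> {}" using chU by simp
    ultimately show ?thesis by auto
  qed
  then have alt: "alternation_number ?A \<le> 0"
    by (simp add: alternation_number_def)
  have "defines_graph ?A G"
    using us ne v unique sieve by (rule defines_graph_parts)
  then have "enat (quantifier_depth ?A) \<in> {enat (quantifier_depth A) | A.
     sentence A \<and> negation_inside A \<and> alternation_number A \<le> 0 \<and> defines_graph A G}"
    using sent neg alt by blast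
  then have "D 0 G \<le> enat (quantifier_depth ?A)"
    unfolding D_def by (rule Inf_lower)
  then show ?thesis using depth by simp
qed

subsection \<open>Agreement of independent bits\<close>

text \<open>Both numbers are at most the Euclidean norm, which can therefore replace all but two
  factors of each power.\<close>

lemma power_sum_le_l2_power:
  fixes a b :: real
  assumes "0 \<le> a" "0 \<le> b" "2 \<le> c"
  shows "a ^ c + b ^ c \<le> sqrt (a\<^sup>2 + b\<^sup>2) ^ c"
proof -
  define s where "s = sqrt (a\<^sup>2 + b\<^sup>2)"
  obtain d where c: "c = d + 2" using assms(3) nat_le_iff_add by (metis add.commute)
  have s2: "s\<^sup>2 = a\<^sup>2 + b\<^sup>2" by (simp add: s_def)
  have "a \<le> s" "b \<le> s"
    using assms by (auto simp: s_def intro!: real_le_rsqrt)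
  then have "a ^ d * a\<^sup>2 \<le> s ^ d * a\<^sup>2" "b ^ d * b\<^sup>2 \<le> s ^ d * b\<^sup>2"
    using assms by (auto intro!: mult_right_mono power_mono)
  then have "a ^ d * a\<^sup>2 + b ^ d * b\<^sup>2 \<le> s ^ d * s\<^sup>2"
    by (simp add: s2 distrib_left)
  then show ?thesis unfolding c power_add s_def[symmetric] .
qed

text \<open>A union bound over the values \<open>c\<close> taken on the blocks: for fixed
  \<open>c\<close> the event is a product event, and the sum over all \<open>c\<close> factorizes
  into one factor per block. The exponents then add up to \<open>card M\<close>.\<close>

lemma prob_constant_on_blocks_le:
  assumes I: "finite I" and M: "M \<subseteq> I" and part: "partition_on M \<Q>"
    and size: "\<And>Q. Q \<in> \<Q> \<Longrightarrow> 2 \<le> card Q" and p: "0 \<le> p" "p \<le> 1"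
  shows "measure_pmf.prob (Pi_pmf I d (\<lambda>_. bernoulli_pmf p)) {b. \<forall>Q\<in>\<Q>. \<forall>x\<in>Q. \<forall>y\<in>Q. b x = b y}
    \<le> sqrt (p\<^sup>2 + (1 - p)\<^sup>2) ^ card M"
proof -
  let ?P = "Pi_pmf I d (\<lambda>_. bernoulli_pmf p)"
  have finM: "finite M" using I M finite_subset by blast
  have fin\<Q>: "finite \<Q>" using finite_elements[OF finM part] .
  have finQ: "finite Q" if "Q \<in> \<Q>" for Q
    using that finM partition_onD1[OF part] by (metis Union_upper finite_subset)
  have neQ: "Q \<noteq> {}" if "Q \<in> \<Q>" for Q
    using partition_onD3[OF part] that by blast
  have disj: "Q \<inter> R = {}" if "Q \<in> \<Q>" "R \<in> \<Q>" "Q \<noteq> R" for Q R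
    using partition_onD2[OF part] that by (auto simp: disjoint_def)
  \<comment> \<open>An index outside all blocks is unconstrained and contributes a factor 1; one
    inside a block has a single allowed value, as the blocks are disjoint.\<close>
  define box where "box c = Pi I (\<lambda>x. {y. \<forall>Q\<in>\<Q>. x \<in> Q \<longrightarrow> y = c Q})" for c :: "'a set \<Rightarrow> bool"
  let ?C = "\<Q> \<rightarrow>\<^sub>E (UNIV :: bool set)"
  have finC: "finite ?C" using fin\<Q> by (simp add: finite_PiE)
  have "{b. \<forall>Q\<in>\<Q>. \<forall>x\<in>Q. \<forall>y\<in>Q. b x = b y} \<subseteq> (\<Union>c\<in>?C. box c)"
  proof
    fix b :: "'a \<Rightarrow> bool" assume b: "b \<in> {b. \<forall>Q\<in>\<Q>. \<forall>x\<in>Q. \<forall>y\<in>Q. b x = b y}"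
    define c where "c = restrict (\<lambda>Q. b (SOME x. x \<in> Q)) \<Q>"
    have "b x = c Q" if "Q \<in> \<Q>" "x \<in> Q" for Q x
    proof -
      have "(SOME x. x \<in> Q) \<in> Q" using that(2) by (rule someI)
      then have "b x = b (SOME x. x \<in> Q)" using b that by blast
      then show ?thesis using that(1) by (simp add: c_def)
    qed
    then have "b \<in> box c" by (auto simp: box_def)
    then show "b \<in> (\<Union>c\<in>?C. box c)" by (auto simp: c_def)
  qed
  then have "measure_pmf.prob ?P {b. \<forall>Q\<in>\<Q>. \<forall>x\<in>Q. \<forall>y\<in>Q. b x = b y} \<le> measure_pmf.prob ?P (\<Union>c\<in>?C. box c)"
    by (intro measure_pmf.finite_measure_mono) auto
  also have "\<dots> \<le> (\<Sum>c\<in>?C. measure_pmf.prob ?P (box c))"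
    by (intro measure_pmf.finite_measure_subadditive_finite finC) auto
  also have "\<dots> = (\<Sum>c\<in>?C. \<Prod>Q\<in>\<Q>. pmf (bernoulli_pmf p) (c Q) ^ card Q)"
  proof (rule sum.cong[OF refl])
    fix c
    let ?f = "\<lambda>x. measure_pmf.prob (bernoulli_pmf p) {y. \<forall>Q\<in>\<Q>. x \<in> Q \<longrightarrow> y = c Q}"
    have "measure_pmf.prob ?P (box c) = (\<Prod>x\<in>I. ?f x)"
      unfolding box_def by (rule measure_Pi_pmf_Pi[OF I])
    also have "\<dots> = (\<Prod>x\<in>M. ?f x)"
    proof (rule prod.mono_neutral_right[OF I M], rule ballI)
      fix x assume "x \<in> I - M"
      then have "{y. \<forall>Q\<in>\<Q>. x \<in> Q \<longrightarrow> y = c Q} = UNIV"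
        using partition_onD1[OF part] by auto
      then show "?f x = 1" by simp
    qed
    also have "\<dots> = (\<Prod>x\<in>\<Union>\<Q>. ?f x)" using partition_onD1[OF part] by simp
    also have "\<dots> = (\<Prod>Q\<in>\<Q>. \<Prod>x\<in>Q. ?f x)"
      using finQ disj by (subst prod.Union_disjoint) auto
    also have "\<dots> = (\<Prod>Q\<in>\<Q>. \<Prod>x\<in>Q. pmf (bernoulli_pmf p) (c Q))"
    proof (intro prod.cong refl)
      fix Q x assume "Q \<in> \<Q>" "x \<in> Q"
      then have "{y. \<forall>Q\<in>\<Q>. x \<in> Q \<longrightarrow> y = c Q} = {c Q}" using disj by blast
      then show "?f x = pmf (bernoulli_pmf p) (c Q)" by (simp add: measure_pmf_single)
    qed
    finally show "measure_pmf.prob ?P (box c) = (\<Prod>Q\<in>\<Q>. pmf (bernoulli_pmf p) (c Q) ^ card Q)"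
      by simp
  qed
  also have "\<dots> = (\<Prod>Q\<in>\<Q>. \<Sum>y\<in>UNIV. pmf (bernoulli_pmf p) y ^ card Q)"
    using fin\<Q> by (subst prod_sum_PiE) auto
  also have "\<dots> = (\<Prod>Q\<in>\<Q>. p ^ card Q + (1 - p) ^ card Q)"
    using p by (simp add: UNIV_bool add.commute)
  also have "\<dots> \<le> (\<Prod>Q\<in>\<Q>. sqrt (p\<^sup>2 + (1 - p)\<^sup>2) ^ card Q)"
    using p size by (intro prod_mono conjI power_sum_le_l2_power) auto
  also have "\<dots> = sqrt (p\<^sup>2 + (1 - p)\<^sup>2) ^ (\<Sum>Q\<in>\<Q>. card Q)"
    by (simp add: power_sum)
  also have "(\<Sum>Q\<in>\<Q>. card Q) = card M"
    using product_partition[OF part] finQ by simp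
  finally show ?thesis .
qed

text \<open>The blocks are the classes of indices on which the constraints force \<open>b\<close> to agree.
  Since \<open>f\<close> has no fixed point in \<open>E\<close>, no block is a singleton; the bound does not require
  the constraints to be independent.\<close>

lemma prob_all_equal_image_le:
  fixes f :: "'a \<Rightarrow> 'a"
  assumes I: "finite I" and E: "E \<subseteq> I" "f ` E \<subseteq> I" and f: "\<And>e. e \<in> E \<Longrightarrow> f e \<noteq> e"
    and p: "0 \<le> p" "p \<le> 1"
  shows "measure_pmf.prob (Pi_pmf I d (\<lambda>_. bernoulli_pmf p)) {b. \<forall>e\<in>E. b (f e) = b e}
    \<le> sqrt (p\<^sup>2 + (1 - p)\<^sup>2) ^ card (E \<union> f ` E)"
proof -
  define M where "M = E \<union> f ` E"
  \<comment> \<open>Quantifying over all solutions \<open>b\<close> makes \<open>R\<close> an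
    equivalence relation at once, with no need to form the closure of the links from
    \<open>e\<close> to \<open>f e\<close>.\<close>
  define R where "R = {(x, y). x \<in> M \<and> y \<in> M \<and> (\<forall>b :: 'a \<Rightarrow> bool. (\<forall>e\<in>E. b (f e) = b e) \<longrightarrow> b x = b y)}"
  have M: "M \<subseteq> I" using E by (auto simp: M_def)
  have equiv: "equiv M R"
    by (rule equivI) (auto simp: R_def refl_on_def sym_def trans_def)
  have "2 \<le> card Q" if "Q \<in> M // R" for Q
  proof -
    obtain x where x: "x \<in> M" "Q = R `` {x}" using \<open>Q \<in> M // R\<close> by (auto elim: quotientE)
    obtain e where e: "e \<in> E" "x = e \<or> x = f e" using x(1) by (auto simp: M_def)
    then have "{e, f e} \<subseteq> Q" using x by (auto simp: R_def M_def)
    moreover have "finite Q"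
      using x I M by (auto simp: R_def intro: rev_finite_subset[of M] finite_subset)
    ultimately have "card {e, f e} \<le> card Q" by (metis card_mono)
    then show ?thesis using f[OF e(1)] by simp
  qed
  then have "measure_pmf.prob (Pi_pmf I d (\<lambda>_. bernoulli_pmf p)) {b. \<forall>Q\<in>M // R. \<forall>x\<in>Q. \<forall>y\<in>Q. b x = b y}
    \<le> sqrt (p\<^sup>2 + (1 - p)\<^sup>2) ^ card M"
    by (intro prob_constant_on_blocks_le I M p partition_on_quotient equiv)
  moreover have "measure_pmf.prob (Pi_pmf I d (\<lambda>_. bernoulli_pmf p)) {b. \<forall>e\<in>E. b (f e) = b e}
      \<le> measure_pmf.prob (Pi_pmf I d (\<lambda>_. bernoulli_pmf p)) {b. \<forall>Q\<in>M // R. \<forall>x\<in>Q. \<forall>y\<in>Q. b x = b y}"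
  proof (intro measure_pmf.finite_measure_mono subsetI)
    fix b :: "'a \<Rightarrow> bool" assume b: "b \<in> {b. \<forall>e\<in>E. b (f e) = b e}"
    have "b x = b y" if "Q \<in> M // R" "x \<in> Q" "y \<in> Q" for Q x y
      using quotient_eq_iff[OF equiv that(1,1,2,3)] b by (auto simp: R_def)
    then show "b \<in> {b. \<forall>Q\<in>M // R. \<forall>x\<in>Q. \<forall>y\<in>Q. b x = b y}" by blast
  qed simp
  ultimately show ?thesis by (simp add: M_def)
qed

subsection \<open>Embeddings and sieves in the random graph\<close>

lemma finite_pairs_of: "finite V \<Longrightarrow> finite (pairs_of V)"
  by (rule finite_subset[of _ "Pow V"]) (auto simp: pairs_of_def)

lemma pair_in_pairs_of [simp]: "{u, w} \<in> pairs_of V \<longleftrightarrow> u \<in> V \<and> w \<in> V \<and> u \<noteq> w"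
  by (auto simp: pairs_of_def card_insert_if)

text \<open>Double counting of incidences: an edge has at most two ends in \<open>S\<close>.\<close>

lemma degree_mult_card_le:
  assumes X: "finite X" and S: "S \<subseteq> X" and E: "E \<subseteq> pairs_of X"
    and deg: "\<And>i. i \<in> S \<Longrightarrow> d \<le> card {j. {i, j} \<in> E}"
  shows "card S * d \<le> 2 * card E"
proof -
  have finS: "finite S" and finE: "finite E"
    using X S E finite_pairs_of finite_subset by blast+
  have "d \<le> card {e \<in> E. i \<in> e}" if "i \<in> S" for i
  proof -
    have "inj_on (\<lambda>j. {i, j}) {j. {i, j} \<in> E}"
      by (auto simp: inj_on_def doubleton_eq_iff)
    moreover have "(\<lambda>j. {i, j}) ` {j. {i, j} \<in> E} \<subseteq> {e \<in> E. i \<in> e}" by auto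
    ultimately have "card {j. {i, j} \<in> E} \<le> card {e \<in> E. i \<in> e}"
      using finE by (intro card_inj_on_le) auto
    with deg[OF that] show ?thesis by simp
  qed
  then have "card S * d \<le> (\<Sum>i\<in>S. card {e \<in> E. i \<in> e})"
    using sum_bounded_below[of S d "\<lambda>i. card {e \<in> E. i \<in> e}"] by simp
  also have "\<dots> = (\<Sum>e\<in>E. card {i \<in> S. i \<in> e})"
    using finS finE by (rule sum_multicount_gen) simp
  also have "\<dots> \<le> (\<Sum>e\<in>E. 2)"
  proof (rule sum_mono)
    fix e assume "e \<in> E"
    then have "card e = 2" using E by (auto simp: pairs_of_def)
    then have "card {i \<in> S. i \<in> e} \<le> card e"
      by (intro card_mono) (auto intro: card_ge_0_finite)
    then show "card {i \<in> S. i \<in> e} \<le> 2" using \<open>card e = 2\<close> by simp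
  qed
  finally show ?thesis by simp
qed

text \<open>Pairs are compared as sets: a pair whose ends are swapped imposes no constraint and does
  not count as moved.\<close>

definition moved_pairs :: "'a set \<Rightarrow> ('a \<Rightarrow> 'a) \<Rightarrow> 'a set set" where
  "moved_pairs X f = {e \<in> pairs_of X. f ` e \<noteq> e}"

definition leaving_pairs :: "'a set \<Rightarrow> ('a \<Rightarrow> 'a) \<Rightarrow> 'a set set" where
  "leaving_pairs X f = {e \<in> pairs_of X. \<not> f ` e \<subseteq> X}"

text \<open>If \<open>f\<close> moves \<open>i\<close> but fixes the pair of \<open>i\<close> and
  \<open>j\<close> as a set, then \<open>j = f i\<close>. So every \<open>j\<close> in
  \<open>X\<close> other than \<open>i\<close> and \<open>f i\<close> gives a moved pair.\<close>

lemma card_moved_pairs: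
  assumes X: "finite X"
  shows "card {x \<in> X. f x \<noteq> x} * (card X - 2) \<le> 2 * card (moved_pairs X f)"
proof (rule degree_mult_card_le[OF X])
  fix i assume i: "i \<in> {x \<in> X. f x \<noteq> x}"
  have card_i: "card {i, f i} = 2" using i by (auto simp: card_2_iff)
  have "X - {i, f i} \<subseteq> {j. {i, j} \<in> moved_pairs X f}"
    using i by (auto simp: moved_pairs_def doubleton_eq_iff)
  moreover have "finite {j. {i, j} \<in> moved_pairs X f}"
    by (rule finite_subset[OF _ X]) (auto simp: moved_pairs_def)
  ultimately have "card (X - {i, f i}) \<le> card {j. {i, j} \<in> moved_pairs X f}"
    by (rule card_mono[rotated])
  moreover have "card X - card {i, f i} \<le> card (X - {i, f i})"
    by (rule diff_card_le_card_Diff) simp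
  ultimately show "card X - 2 \<le> card {j. {i, j} \<in> moved_pairs X f}"
    using card_i by simp
qed (auto simp: moved_pairs_def)

lemma card_leaving_pairs:
  assumes X: "finite X"
  shows "card {x \<in> X. f x \<notin> X} * (card X - 1) \<le> 2 * card (leaving_pairs X f)"
proof (rule degree_mult_card_le[OF X])
  fix i assume i: "i \<in> {x \<in> X. f x \<notin> X}"
  have "X - {i} \<subseteq> {j. {i, j} \<in> leaving_pairs X f}"
    using i by (auto simp: leaving_pairs_def)
  moreover have "finite {j. {i, j} \<in> leaving_pairs X f}"
    by (rule finite_subset[OF _ X]) (auto simp: leaving_pairs_def)
  ultimately have "card (X - {i}) \<le> card {j. {i, j} \<in> leaving_pairs X f}"
    by (rule card_mono[rotated])
  then show "card X - 1 \<le> card {j. {i, j} \<in> leaving_pairs X f}"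
    using i by simp
qed (auto simp: leaving_pairs_def)

text \<open>Images of leaving pairs are distinct by injectivity, and they are not contained in
  \<open>X\<close>, hence differ from all moved pairs.\<close>

lemma card_moved_pairs_Un_image:
  assumes X: "finite X" and f: "inj_on f X"
  shows "card (moved_pairs X f) + card (leaving_pairs X f) \<le> card (moved_pairs X f \<union> (`) f ` (moved_pairs X f))"
proof -
  have fin: "finite (moved_pairs X f)" "finite (leaving_pairs X f)"
    using finite_pairs_of[OF X] by (auto simp: moved_pairs_def leaving_pairs_def)
  have sub: "leaving_pairs X f \<subseteq> moved_pairs X f"
    by (auto simp: moved_pairs_def leaving_pairs_def pairs_of_def)
  have "inj_on ((`) f) (leaving_pairs X f)"
    by (rule inj_on_subset[OF inj_on_image_Pow[OF f]]) (auto simp: leaving_pairs_def pairs_of_def)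
  then have "card (moved_pairs X f) + card (leaving_pairs X f) = card (moved_pairs X f) + card ((`) f ` (leaving_pairs X f))"
    by (simp add: card_image)
  also have "\<dots> = card (moved_pairs X f \<union> (`) f ` (leaving_pairs X f))"
    using fin by (intro card_Un_disjoint[symmetric]) (auto simp: moved_pairs_def leaving_pairs_def pairs_of_def)
  also have "\<dots> \<le> card (moved_pairs X f \<union> (`) f ` (moved_pairs X f))"
    using fin sub by (intro card_mono) auto
  finally show ?thesis .
qed

text \<open>With \<open>k = card X\<close> and \<open>s\<close> the fourth root of \<open>p\<^sup>2 + (1 - p)\<^sup>2\<close>, the product of these
  factors over \<open>x \<in> X\<close>, at \<open>y = f x\<close>, bounds the probability that \<open>f\<close> embeds the random graph
  on \<open>X\<close> into the whole one: a vertex moved by \<open>f\<close> lies in at least \<open>k - 2\<close> moved pairs, and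
  one sent outside \<open>X\<close> in \<open>k - 1\<close> pairs whose images are new. Having a product as the bound
  makes the sum over all \<open>f\<close> factorize.\<close>

definition embedding_weight :: "'a set \<Rightarrow> real \<Rightarrow> 'a \<Rightarrow> 'a \<Rightarrow> real" where
  "embedding_weight X s x y =
     (if y = x then 1 else if y \<in> X then s ^ (card X - 2) else s ^ (2 * card X - 3))"

text \<open>The degree counts bound twice the number of constrained pairs from below, which is why
  \<open>s\<close> is a fourth root and not a square root.\<close>

lemma prob_embedding_le:
  fixes p s :: real
  assumes V: "finite V" and X: "X \<subseteq> V" "2 \<le> card X" and f: "f ` X \<subseteq> V" "inj_on f X"
    and p: "0 \<le> p" "p \<le> 1"
  defines "s \<equiv> sqrt (sqrt (p\<^sup>2 + (1 - p)\<^sup>2))"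
  shows "measure_pmf.prob (Pi_pmf (pairs_of V) d (\<lambda>_. bernoulli_pmf p)) {b. \<forall>e\<in>pairs_of X. b (f ` e) = b e}
    \<le> (\<Prod>x\<in>X. embedding_weight X s x (f x))"
proof -
  let ?P = "Pi_pmf (pairs_of V) d (\<lambda>_. bernoulli_pmf p)"
  let ?E = "moved_pairs X f" and ?k = "card X"
  have finX: "finite X" using X V finite_subset by blast
  have "p\<^sup>2 + (1 - p)\<^sup>2 = 1 - 2 * (p * (1 - p))" by (simp add: power2_eq_square algebra_simps)
  moreover have "0 \<le> p * (1 - p)" using p by simp
  ultimately have "p\<^sup>2 + (1 - p)\<^sup>2 \<le> 1" by linarith
  then have s: "0 \<le> s" "s \<le> 1" by (auto simp: s_def)
  let ?t = "\<lambda>x. if f x = x then 0 else if f x \<in> X then ?k - 2 else 2 * ?k - 3"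
  have "measure_pmf.prob ?P {b. \<forall>e\<in>pairs_of X. b (f ` e) = b e}
      \<le> measure_pmf.prob ?P {b. \<forall>e\<in>?E. b (f ` e) = b e}"
    by (intro measure_pmf.finite_measure_mono) (auto simp: moved_pairs_def)
  also have "\<dots> \<le> sqrt (p\<^sup>2 + (1 - p)\<^sup>2) ^ card (?E \<union> (`) f ` ?E)"
  proof (intro prob_all_equal_image_le finite_pairs_of V p)
    show "?E \<subseteq> pairs_of V" using X by (auto simp: moved_pairs_def pairs_of_def)
    show "(`) f ` ?E \<subseteq> pairs_of V"
    proof
      fix e' assume "e' \<in> (`) f ` ?E"
      then obtain e where e: "e' = f ` e" "e \<subseteq> X" "card e = 2"
        by (auto simp: moved_pairs_def pairs_of_def)
      then show "e' \<in> pairs_of V"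
        using f inj_on_subset[OF f(2) e(2)] by (auto simp: pairs_of_def card_image)
    qed
  qed (auto simp: moved_pairs_def)
  also have "\<dots> = s ^ (2 * card (?E \<union> (`) f ` ?E))"
    using p by (simp add: s_def power_mult)
  also have "\<dots> \<le> s ^ (\<Sum>x\<in>X. ?t x)"
  proof (rule power_decreasing[OF _ s])
    \<comment> \<open>A vertex leaving \<open>X\<close> is also moved, so it collects both terms;
      with \<open>2 \<le> card X\<close> the truncated differences add up to
      \<open>2 * card X - 3\<close>.\<close>
    have "(\<Sum>x\<in>X. ?t x) = (\<Sum>x\<in>X. (if f x \<noteq> x then ?k - 2 else 0) + (if f x \<notin> X then ?k - 1 else 0))"
      using X(2) by (intro sum.cong) auto
    also have "\<dots> = card {x \<in> X. f x \<noteq> x} * (?k - 2) + card {x \<in> X. f x \<notin> X} * (?k - 1)"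
      using finX by (simp add: sum.distrib sum.inter_filter[symmetric])
    also have "\<dots> \<le> 2 * card ?E + 2 * card (leaving_pairs X f)"
      using card_moved_pairs[OF finX] card_leaving_pairs[OF finX] by (rule add_mono)
    also have "\<dots> \<le> 2 * card (?E \<union> (`) f ` ?E)"
      using card_moved_pairs_Un_image[OF finX f(2)] by simp
    finally show "(\<Sum>x\<in>X. ?t x) \<le> 2 * card (?E \<union> (`) f ` ?E)" .
  qed
  also have "s ^ (\<Sum>x\<in>X. ?t x) = (\<Prod>x\<in>X. embedding_weight X s x (f x))"
    by (auto simp: power_sum embedding_weight_def intro!: prod.cong)
  finally show ?thesis .
qed

lemma sum_embedding_weight_le:
  fixes s :: real
  assumes V: "finite V" and x: "x \<in> V" and X: "X \<subseteq> V" and s: "0 \<le> s"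
  shows "(\<Sum>y\<in>V. embedding_weight X s x y)
    \<le> 1 + (card X * s ^ (card X - 2) + card V * s ^ (2 * card X - 3))"
proof -
  have "(\<Sum>y\<in>V. embedding_weight X s x y)
      \<le> (\<Sum>y\<in>V. (if y = x then 1 else 0) + ((if y \<in> X then s ^ (card X - 2) else 0) + s ^ (2 * card X - 3)))"
    using s by (intro sum_mono) (auto simp: embedding_weight_def)
  also have "\<dots> = 1 + ((\<Sum>y\<in>V. if y \<in> X then s ^ (card X - 2) else 0) + card V * s ^ (2 * card X - 3))"
    using V x by (simp add: sum.distrib)
  also have "(\<Sum>y\<in>V. if y \<in> X then s ^ (card X - 2) else 0) = card X * s ^ (card X - 2)"
    using V X by (simp add: sum.If_cases Int_absorb1)
  finally show ?thesis .
qed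

text \<open>A union bound over embeddings, enlarged to all maps from \<open>X\<close> to
  \<open>V\<close> so that the sum of products becomes a product of sums. Each factor has the form
  \<open>1 + a\<close>, bounded by \<open>exp a\<close>.\<close>

lemma prob_nontrivial_embedding_le:
  fixes p s :: real
  assumes V: "finite V" and X: "X \<subseteq> V" "2 \<le> card X" and p: "0 \<le> p" "p \<le> 1"
  defines "s \<equiv> sqrt (sqrt (p\<^sup>2 + (1 - p)\<^sup>2))"
  shows "measure_pmf.prob (Pi_pmf (pairs_of V) d (\<lambda>_. bernoulli_pmf p))
      {b. \<exists>f. f ` X \<subseteq> V \<and> inj_on f X \<and> (\<exists>x\<in>X. f x \<noteq> x) \<and> (\<forall>e\<in>pairs_of X. b (f ` e) = b e)}
    \<le> exp (card X * (card X * s ^ (card X - 2) + card V * s ^ (2 * card X - 3))) - 1"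
proof -
  let ?P = "Pi_pmf (pairs_of V) d (\<lambda>_. bernoulli_pmf p)" and ?w = "embedding_weight X s"
  let ?F = "X \<rightarrow>\<^sub>E V" and ?id = "restrict (\<lambda>x. x) X"
  \<comment> \<open>Restriction to \<open>X\<close> leaves finitely many maps, and the event depends
    on nothing else.\<close>
  define F where "F = {f \<in> X \<rightarrow>\<^sub>E V. inj_on f X \<and> f \<noteq> ?id}"
  define ev where "ev f = {b. \<forall>e\<in>pairs_of X. b (f ` e) = (b e :: bool)}" for f :: "'a \<Rightarrow> 'a"
  have finX: "finite X" using X V finite_subset by blast
  have s: "0 \<le> s" by (simp add: s_def)
  have w: "0 \<le> ?w x y" for x y using s by (simp add: embedding_weight_def)
  have finF: "finite ?F" using finX V by (simp add: finite_PiE)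
  have finF': "finite F" using finF by (simp add: F_def)
  have "{b. \<exists>f. f ` X \<subseteq> V \<and> inj_on f X \<and> (\<exists>x\<in>X. f x \<noteq> x) \<and> (\<forall>e\<in>pairs_of X. b (f ` e) = b e)}
      \<subseteq> (\<Union>f\<in>F. ev f)"
  proof
    fix b :: "'a set \<Rightarrow> bool"
    assume "b \<in> {b. \<exists>f. f ` X \<subseteq> V \<and> inj_on f X \<and> (\<exists>x\<in>X. f x \<noteq> x) \<and> (\<forall>e\<in>pairs_of X. b (f ` e) = b e)}"
    then obtain f x where f: "f ` X \<subseteq> V" "inj_on f X" "x \<in> X" "f x \<noteq> x" "\<forall>e\<in>pairs_of X. b (f ` e) = b e"
      by blast
    have "restrict f X \<noteq> ?id" using f(3,4) by (auto dest: fun_cong[of _ _ x])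
    then have "restrict f X \<in> F" using f(1,2) by (auto simp: F_def inj_on_restrict_eq)
    moreover have "restrict f X ` e = f ` e" if "e \<in> pairs_of X" for e
      using that by (auto simp: pairs_of_def intro!: image_cong)
    then have "b \<in> ev (restrict f X)" using f(5) by (simp add: ev_def)
    ultimately show "b \<in> (\<Union>f\<in>F. ev f)" by blast
  qed
  then have "measure_pmf.prob ?P
      {b. \<exists>f. f ` X \<subseteq> V \<and> inj_on f X \<and> (\<exists>x\<in>X. f x \<noteq> x) \<and> (\<forall>e\<in>pairs_of X. b (f ` e) = b e)}
      \<le> measure_pmf.prob ?P (\<Union>f\<in>F. ev f)"
    by (intro measure_pmf.finite_measure_mono) auto
  also have "\<dots> \<le> (\<Sum>f\<in>F. measure_pmf.prob ?P (ev f))"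
    by (intro measure_pmf.finite_measure_subadditive_finite finF') auto
  also have "\<dots> \<le> (\<Sum>f\<in>F. \<Prod>x\<in>X. ?w x (f x))"
  proof (rule sum_mono)
    fix f assume "f \<in> F"
    then show "measure_pmf.prob ?P (ev f) \<le> (\<Prod>x\<in>X. ?w x (f x))"
      unfolding ev_def s_def by (intro prob_embedding_le V X p) (auto simp: F_def PiE_def)
  qed
  also have "\<dots> \<le> (\<Sum>f\<in>?F - {?id}. \<Prod>x\<in>X. ?w x (f x))"
    using finF w by (intro sum_mono2 prod_nonneg) (auto simp: F_def)
  \<comment> \<open>The identity has weight 1 at every vertex.\<close>
  also have "\<dots> = (\<Sum>f\<in>?F. \<Prod>x\<in>X. ?w x (f x)) - 1"
    using finF X(1) by (subst sum_diff1) (auto simp: embedding_weight_def)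
  also have "(\<Sum>f\<in>?F. \<Prod>x\<in>X. ?w x (f x)) = (\<Prod>x\<in>X. \<Sum>y\<in>V. ?w x y)"
    using finX V by (simp add: prod_sum_PiE)
  also have "\<dots> \<le> (\<Prod>x\<in>X. exp (card X * s ^ (card X - 2) + card V * s ^ (2 * card X - 3)))"
  proof (intro prod_mono conjI)
    fix x assume "x \<in> X"
    then have "(\<Sum>y\<in>V. ?w x y) \<le> 1 + (card X * s ^ (card X - 2) + card V * s ^ (2 * card X - 3))"
      using X(1) by (intro sum_embedding_weight_le V s) auto
    also have "\<dots> \<le> exp (card X * s ^ (card X - 2) + card V * s ^ (2 * card X - 3))"
      by (rule exp_ge_add_one_self)
    finally show "(\<Sum>y\<in>V. ?w x y) \<le> exp (card X * s ^ (card X - 2) + card V * s ^ (2 * card X - 3))" .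
  qed (use w in \<open>auto intro: sum_nonneg\<close>)
  also have "\<dots> = exp (card X * (card X * s ^ (card X - 2) + card V * s ^ (2 * card X - 3)))"
    by (simp add: exp_of_nat_mult[symmetric])
  finally show ?thesis by simp
qed

section \<open>Separation of vertices by their neighbourhoods in \<open>X\<close>\<close>

lemma prob_not_separated_le:
  fixes p :: real
  assumes V: "finite V" and X: "X \<subseteq> V" and uw: "u \<in> V - X" "w \<in> V - X" "u \<noteq> w"
    and p: "0 \<le> p" "p \<le> 1"
  shows "measure_pmf.prob (Pi_pmf (pairs_of V) d (\<lambda>_. bernoulli_pmf p)) {b. \<forall>x\<in>X. b {w, x} = b {u, x}}
    \<le> (p\<^sup>2 + (1 - p)\<^sup>2) ^ card X"
proof -
  \<comment> \<open>The map exchanges the end \<open>u\<close> for \<open>w\<close>. As both lie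
    outside \<open>X\<close>, the pairs and their images are \<open>2 * card X\<close> distinct
    indices, which cancels the square root.\<close>
  let ?E = "(\<lambda>x. {u, x}) ` X" and ?f = "\<lambda>e. insert w (e - {u})"
  have finX: "finite X" using X V finite_subset by blast
  have f: "?f {u, x} = {w, x}" if "x \<in> X" for x using that uw by auto
  have fE: "?f ` ?E = (\<lambda>x. {w, x}) ` X"
    unfolding image_image using f by (rule image_cong[OF refl])
  have "measure_pmf.prob (Pi_pmf (pairs_of V) d (\<lambda>_. bernoulli_pmf p)) {b. \<forall>e\<in>?E. b (?f e) = b e}
      \<le> sqrt (p\<^sup>2 + (1 - p)\<^sup>2) ^ card (?E \<union> ?f ` ?E)"
  proof (intro prob_all_equal_image_le finite_pairs_of V p)
    show "?E \<subseteq> pairs_of V" using X uw by auto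
    show "?f ` ?E \<subseteq> pairs_of V" unfolding fE using X uw by auto
  qed (use uw in auto)
  moreover have "card (?E \<union> ?f ` ?E) = 2 * card X"
  proof -
    have "inj_on (\<lambda>x. {u, x}) X" "inj_on (\<lambda>x. {w, x}) X"
      by (auto simp: inj_on_def doubleton_eq_iff)
    moreover have "?E \<inter> (\<lambda>x. {w, x}) ` X = {}"
      using uw by (auto simp: doubleton_eq_iff)
    ultimately show ?thesis unfolding fE using finX by (simp add: card_Un_disjoint card_image)
  qed
  moreover have "{b. \<forall>e\<in>?E. b (?f e) = b e} = {b. \<forall>x\<in>X. b {w, x} = (b {u, x} :: bool)}"
    using f by auto
  ultimately show ?thesis by (simp add: power_mult)
qed

lemma prob_not_sieve_le:
  fixes p :: real
  assumes V: "finite V" and X: "X \<subseteq> V" and p: "0 \<le> p" "p \<le> 1"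
  shows "measure_pmf.prob (Pi_pmf (pairs_of V) d (\<lambda>_. bernoulli_pmf p))
      {b. \<exists>u\<in>V - X. \<exists>w\<in>V - X. u \<noteq> w \<and> (\<forall>x\<in>X. b {w, x} = b {u, x})}
    \<le> (card V)\<^sup>2 * (p\<^sup>2 + (1 - p)\<^sup>2) ^ card X"
proof -
  let ?P = "Pi_pmf (pairs_of V) d (\<lambda>_. bernoulli_pmf p)"
  define S where "S = {(u, w). u \<in> V - X \<and> w \<in> V - X \<and> u \<noteq> w}"
  have S: "S \<subseteq> V \<times> V" by (auto simp: S_def)
  then have finS: "finite S" using V by (meson finite_SigmaI finite_subset)
  have "card S \<le> card (V \<times> V)" using V S by (intro card_mono) auto
  then have cardS: "card S \<le> (card V)\<^sup>2" by (simp add: card_cartesian_product power2_eq_square)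
  have "{b. \<exists>u\<in>V - X. \<exists>w\<in>V - X. u \<noteq> w \<and> (\<forall>x\<in>X. b {w, x} = b {u, x})}
      = (\<Union>(u, w)\<in>S. {b. \<forall>x\<in>X. b {w, x} = (b {u, x} :: bool)})"
    by (auto simp: S_def)
  then have "measure_pmf.prob ?P {b. \<exists>u\<in>V - X. \<exists>w\<in>V - X. u \<noteq> w \<and> (\<forall>x\<in>X. b {w, x} = b {u, x})}
      = measure_pmf.prob ?P (\<Union>(u, w)\<in>S. {b. \<forall>x\<in>X. b {w, x} = (b {u, x} :: bool)})"
    by simp
  also have "\<dots> \<le> (\<Sum>(u, w)\<in>S. measure_pmf.prob ?P {b. \<forall>x\<in>X. b {w, x} = (b {u, x} :: bool)})"
    unfolding case_prod_unfold
    by (intro measure_pmf.finite_measure_subadditive_finite finS) auto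
  also have "\<dots> \<le> (\<Sum>(u, w)\<in>S. (p\<^sup>2 + (1 - p)\<^sup>2) ^ card X)"
    by (rule sum_mono) (auto simp: S_def intro!: prob_not_separated_le V X p)
  also have "\<dots> = card S * (p\<^sup>2 + (1 - p)\<^sup>2) ^ card X"
    by (simp add: case_prod_unfold)
  also have "\<dots> \<le> (card V)\<^sup>2 * (p\<^sup>2 + (1 - p)\<^sup>2) ^ card X"
    using cardS by (intro mult_right_mono) (auto simp flip: of_nat_power)
  finally show ?thesis by simp
qed

section \<open>From edge indicators to the depth bound\<close>

lemma D_0_le_if_sieve_and_unique:
  fixes b :: "nat set \<Rightarrow> bool" and n k :: nat
  defines "G \<equiv> ({1..n}, {e \<in> pairs_of {1..n}. b e})"
  assumes k: "0 < k" "k \<le> n"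
    and sieve: "\<And>u w. \<lbrakk>u \<in> {1..n} - {1..k}; w \<in> {1..n} - {1..k};
        \<And>x. x \<in> {1..k} \<Longrightarrow> b {w, x} = b {u, x}\<rbrakk> \<Longrightarrow> u = w"
    and unique: "\<And>f x. \<lbrakk>f ` {1..k} \<subseteq> {1..n}; inj_on f {1..k};
        \<And>e. e \<in> pairs_of {1..k} \<Longrightarrow> b (f ` e) = b e; x \<in> {1..k}\<rbrakk> \<Longrightarrow> f x = x"
  shows "D 0 G \<le> enat (k + 2)"
\<comment> \<open>\<open>Suc\<close> matches the variables, counted from 0, with the vertices of
  \<open>{1..k}\<close>.\<close>
proof (rule D_0_le[where v = Suc])
  have adj: "adjacent G u w \<longleftrightarrow> u \<in> {1..n} \<and> w \<in> {1..n} \<and> u \<noteq> w \<and> b {u, w}" for u w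
    by (auto simp: adjacent_def G_def)
  show "finite (fst G)" "0 < k" using k by (auto simp: G_def)
  show "Suc i \<in> fst G" if "i < k" for i using that k by (auto simp: G_def)
  show "\<tau> i = Suc i" if \<tau>: "\<And>i. i < k \<Longrightarrow> \<tau> i \<in> fst G" and sd: "same_diagram k G Suc G \<tau>" and i: "i < k" for \<tau> i
  proof -
    define f where "f x = \<tau> (x - 1)" for x
    have fV: "f ` {1..k} \<subseteq> {1..n}" using \<tau> by (auto simp: f_def G_def)
    have same: "(f x = f y \<longleftrightarrow> x = y) \<and> (adjacent G (f x) (f y) \<longleftrightarrow> adjacent G x y)"
      if "x \<in> {1..k}" "y \<in> {1..k}" for x y
    proof -
      have "x - 1 < k" "y - 1 < k" "Suc (x - 1) = x" "Suc (y - 1) = y" using that by auto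
      then show ?thesis using sd unfolding same_diagram_def f_def by metis
    qed
    have "b (f ` e) = b e" if e: "e \<in> pairs_of {1..k}" for e
    proof -
      obtain x y where xy: "e = {x, y}" "x \<noteq> y" "x \<in> {1..k}" "y \<in> {1..k}"
        using e by (auto simp: pairs_of_def card_2_iff)
      then have "f x \<in> {1..n}" "f y \<in> {1..n}" using fV by blast+
      moreover have "x \<in> {1..n}" "y \<in> {1..n}" using xy k by auto
      ultimately show ?thesis using same[OF xy(3,4)] xy(1,2) by (auto simp: adj)
    qed
    moreover have "inj_on f {1..k}" using same by (auto simp: inj_on_def)
    ultimately have "f (Suc i) = Suc i" using fV i by (intro unique) auto
    then show ?thesis by (simp add: f_def)
  qed
  show "u = w" if "u \<in> fst G" "w \<in> fst G" and
    eq: "\<And>i. i < k \<Longrightarrow> (u = Suc i \<longleftrightarrow> w = Suc i) \<and> (adjacent G u (Suc i) \<longleftrightarrow> adjacent G w (Suc i))" for u w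
  proof -
    have eq': "(u = x \<longleftrightarrow> w = x) \<and> (adjacent G u x \<longleftrightarrow> adjacent G w x)" if "x \<in> {1..k}" for x
      using eq[of "x - 1"] that by auto
    show ?thesis
    \<comment> \<open>A vertex of \<open>{1..k}\<close> is identified by equality with itself; only
      the others rely on the sieve.\<close>
    proof (cases "u \<in> {1..k} \<or> w \<in> {1..k}")
      case True
      then show ?thesis using eq' by blast
    next
      case False
      have uw: "u \<in> {1..n}" "w \<in> {1..n}" using that by (auto simp: G_def)
      have "b {w, x} = b {u, x}" if "x \<in> {1..k}" for x
      proof -
        have "x \<in> {1..n}" "u \<noteq> x" "w \<noteq> x" using that k False by auto
        then show ?thesis using eq'[OF that] uw by (auto simp: adj)
      qed
      then show ?thesis using uw False by (intro sieve) auto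
    qed
  qed
qed

lemma prob_D_0_le:
  fixes p r s :: real
  assumes k: "2 \<le> k" "k \<le> n" and p: "0 \<le> p" "p \<le> 1"
  defines "r \<equiv> p\<^sup>2 + (1 - p)\<^sup>2"
  defines "s \<equiv> sqrt (sqrt r)"
  shows "measure_pmf.prob (random_graph n p) {G. D 0 G \<le> enat (k + 2)}
    \<ge> 1 - (n\<^sup>2 * r ^ k + (exp (k * (k * s ^ (k - 2) + n * s ^ (2 * k - 3))) - 1))"
proof -
  let ?V = "{1..n}" and ?X = "{1..k}"
  let ?P = "Pi_pmf (pairs_of ?V) False (\<lambda>_. bernoulli_pmf p)"
  let ?g = "\<lambda>b. (?V, {e \<in> pairs_of ?V. b e})"
  define B1 where "B1 = {b :: nat set \<Rightarrow> bool.
      \<exists>u\<in>?V - ?X. \<exists>w\<in>?V - ?X. u \<noteq> w \<and> (\<forall>x\<in>?X. b {w, x} = b {u, x})}"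
  define B2 where "B2 = {b :: nat set \<Rightarrow> bool.
      \<exists>f. f ` ?X \<subseteq> ?V \<and> inj_on f ?X \<and> (\<exists>x\<in>?X. f x \<noteq> x) \<and> (\<forall>e\<in>pairs_of ?X. b (f ` e) = b e)}"
  have "?X \<subseteq> ?V" using k by auto
  then have "measure_pmf.prob ?P B1 \<le> n\<^sup>2 * r ^ k"
    and "measure_pmf.prob ?P B2 \<le> exp (k * (k * s ^ (k - 2) + n * s ^ (2 * k - 3))) - 1"
    using prob_not_sieve_le[of ?V ?X p False] prob_nontrivial_embedding_le[of ?V ?X p False] k p
    by (simp_all add: B1_def B2_def r_def s_def)
  moreover have "measure_pmf.prob ?P (B1 \<union> B2) \<le> measure_pmf.prob ?P B1 + measure_pmf.prob ?P B2"
    by (intro measure_Un_le) auto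
  moreover have "1 - measure_pmf.prob ?P (B1 \<union> B2) = measure_pmf.prob ?P (- (B1 \<union> B2))"
    using measure_pmf.prob_compl[of "B1 \<union> B2" ?P] by (simp add: Compl_eq_Diff_UNIV)
  moreover have "measure_pmf.prob ?P (- (B1 \<union> B2)) \<le> measure_pmf.prob ?P (?g -` {G. D 0 G \<le> enat (k + 2)})"
  proof (intro measure_pmf.finite_measure_mono subsetI)
    fix b assume b: "b \<in> - (B1 \<union> B2)"
    have "D 0 (?g b) \<le> enat (k + 2)"
    proof (rule D_0_le_if_sieve_and_unique)
      show "u = w" if "u \<in> ?V - ?X" "w \<in> ?V - ?X" "\<And>x. x \<in> ?X \<Longrightarrow> b {w, x} = b {u, x}" for u w
        using b that unfolding B1_def by blast
      show "f x = x" if "f ` ?X \<subseteq> ?V" "inj_on f ?X" "\<And>e. e \<in> pairs_of ?X \<Longrightarrow> b (f ` e) = b e" "x \<in> ?X" for f x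
        using b that unfolding B2_def by blast
    qed (use k in auto)
    then show "b \<in> ?g -` {G. D 0 G \<le> enat (k + 2)}" by simp
  qed simp
  ultimately show ?thesis by (simp add: random_graph_def)
qed

subsection \<open>Asymptotics\<close>

text \<open>The summand \<open>2 * sqrt (ln n)\<close> in \<open>k\<close> is of lower order, so the
  leading constant stays 2. Yet it makes the error terms as small as
  \<open>exp (- sqrt (ln n))\<close>, which beats the factors \<open>k\<close> of order
  \<open>ln n\<close>.\<close>

lemma sieve_size_asymptotics:
  fixes p r s L :: real
  assumes p: "0 < p" "p < 1"
  defines "r \<equiv> p\<^sup>2 + (1 - p)\<^sup>2"
  defines "s \<equiv> sqrt (sqrt r)" and "L \<equiv> - ln r"
  defines "k \<equiv> (\<lambda>n. nat \<lceil>(2 * ln (real n) + 2 * sqrt (ln (real n))) / L\<rceil>)"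
  shows "(\<lambda>n. (real (k n) + 2) * L / ln (real n) - 2) \<longlonglongrightarrow> 0"
    and "\<forall>\<^sub>F n in sequentially. 2 \<le> k n \<and> k n \<le> n"
    and "(\<lambda>n. real (n\<^sup>2) * r ^ k n +
        (exp (real (k n) * (real (k n) * s ^ (k n - 2) + real n * s ^ (2 * k n - 3))) - 1)) \<longlonglongrightarrow> 0"
proof -
  have "r = 1 - 2 * (p * (1 - p))" by (simp add: r_def power2_eq_square algebra_simps)
  moreover have "0 < p * (1 - p)" using p by simp
  ultimately have "r < 1" by linarith
  moreover have "0 < r" using p by (simp add: r_def add_pos_pos)
  ultimately have r: "0 < r" "r < 1" by auto
  have L: "0 < L" using r by (simp add: L_def)
  have r_exp: "r = exp (- L)" using r by (simp add: L_def)
  have s_exp: "s = exp (- L / 4)"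
  proof -
    have "sqrt r = exp (- L / 2)"
      by (rule real_sqrt_unique) (simp_all add: r_exp power2_eq_square flip: exp_add)
    moreover have "sqrt (exp (- L / 2)) = exp (- L / 4)"
      by (rule real_sqrt_unique) (simp_all add: power2_eq_square flip: exp_add)
    ultimately show ?thesis by (simp add: s_def)
  qed
  \<comment> \<open>The size before rounding up, to which automated asymptotics applies.\<close>
  define y where "y n = (2 * ln (real n) + 2 * sqrt (ln (real n))) / L" for n :: nat
  have k: "y n \<le> k n" "k n \<le> y n + 1" if "1 \<le> n" for n
  proof -
    have "0 \<le> y n" using that L by (simp add: y_def)
    then show "y n \<le> k n" "k n \<le> y n + 1"
      unfolding k_def y_def[symmetric] by linarith+
  qed
  have k_ev: "\<forall>\<^sub>F n in sequentially. y n \<le> k n \<and> k n \<le> y n + 1"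
    using k by (auto intro: eventually_sequentiallyI[of 1])
  have "\<forall>\<^sub>F n in sequentially. (2::real) \<le> y n"
    unfolding y_def using L by real_asymp
  moreover have "\<forall>\<^sub>F n in sequentially. y n + 1 \<le> real n"
    unfolding y_def using L by real_asymp
  ultimately show k_bounds: "\<forall>\<^sub>F n in sequentially. 2 \<le> k n \<and> k n \<le> n"
    using k_ev by eventually_elim linarith
  show "(\<lambda>n. (real (k n) + 2) * L / ln (real n) - 2) \<longlonglongrightarrow> 0"
  proof (rule tendsto_sandwich)
    show "\<forall>\<^sub>F n in sequentially. (y n + 2) * L / ln (real n) - 2 \<le> (real (k n) + 2) * L / ln (real n) - 2"
      using k_ev eventually_ge_at_top[of 1]
      by eventually_elim (use L in \<open>auto intro!: divide_right_mono mult_right_mono\<close>)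
    show "\<forall>\<^sub>F n in sequentially. (real (k n) + 2) * L / ln (real n) - 2 \<le> (y n + 3) * L / ln (real n) - 2"
      using k_ev eventually_ge_at_top[of 1]
      by eventually_elim (use L in \<open>auto intro!: divide_right_mono mult_right_mono\<close>)
    show "(\<lambda>n. (y n + 2) * L / ln (real n) - 2) \<longlonglongrightarrow> 0" "(\<lambda>n. (y n + 3) * L / ln (real n) - 2) \<longlonglongrightarrow> 0"
      unfolding y_def using L by real_asymp+
  qed
  \<comment> \<open>Bounds the exponent: \<open>k n\<close> is replaced by \<open>y n + 1\<close>
    where it is a factor and by \<open>y n\<close> where it is an exponent of
    \<open>s\<close>.\<close>
  define B where "B n = (y n + 1) * ((y n + 1) * (exp (- (ln (real n) + sqrt (ln (real n))) / 2) * exp (L / 2))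
      + exp (- sqrt (ln (real n))) * exp (3 * L / 4))" for n
  show "(\<lambda>n. real (n\<^sup>2) * r ^ k n +
        (exp (real (k n) * (real (k n) * s ^ (k n - 2) + real n * s ^ (2 * k n - 3))) - 1)) \<longlonglongrightarrow> 0"
  proof (rule tendsto_sandwich)
    show "\<forall>\<^sub>F n in sequentially. 0 \<le> real (n\<^sup>2) * r ^ k n +
        (exp (real (k n) * (real (k n) * s ^ (k n - 2) + real n * s ^ (2 * k n - 3))) - 1)"
      using r s_exp by (intro always_eventually allI add_nonneg_nonneg) auto
    show "\<forall>\<^sub>F n in sequentially. real (n\<^sup>2) * r ^ k n +
        (exp (real (k n) * (real (k n) * s ^ (k n - 2) + real n * s ^ (2 * k n - 3))) - 1)
        \<le> exp (- 2 * sqrt (ln (real n))) + (exp (B n) - 1)"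
      using k_ev k_bounds eventually_ge_at_top[of 1]
    proof eventually_elim
      case (elim n)
      have n: "0 < real n" using elim by simp
      have yL: "y n * L = 2 * ln (real n) + 2 * sqrt (ln (real n))" using L by (simp add: y_def)
      have "y n * L \<le> real (k n) * L" using elim L by simp
      then have kL: "ln (real n) + sqrt (ln (real n)) \<le> real (k n) * L / 2" using yL by simp
      have "real (n\<^sup>2) * r ^ k n = exp (2 * ln (real n) - real (k n) * L)"
        using n by (simp add: r_exp exp_diff exp_double exp_minus field_simps flip: exp_of_nat_mult)
      also have "\<dots> \<le> exp (- 2 * sqrt (ln (real n)))" using kL by simp
      finally have 1: "real (n\<^sup>2) * r ^ k n \<le> exp (- 2 * sqrt (ln (real n)))" .
      \<comment> \<open>Natural and real subtraction agree here, and for \<open>2 * k n - 3\<close>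
        below, because \<open>2 \<le> k n\<close>.\<close>
      have "s ^ (k n - 2) = exp (- (real (k n) * L) / 4 + L / 2)"
        using elim by (simp add: s_exp of_nat_diff field_simps flip: exp_of_nat_mult)
      also have "\<dots> \<le> exp (- (ln (real n) + sqrt (ln (real n))) / 2 + L / 2)"
        unfolding exp_le_cancel_iff using kL by argo
      finally have 2: "s ^ (k n - 2) \<le> exp (- (ln (real n) + sqrt (ln (real n))) / 2) * exp (L / 2)"
        by (simp only: exp_add)
      have "s ^ (2 * k n - 3) = exp (- (real (k n) * L) / 2 + 3 * L / 4)"
        using elim by (simp add: s_exp of_nat_diff field_simps flip: exp_of_nat_mult)
      then have "real n * s ^ (2 * k n - 3) = exp (ln (real n) + (- (real (k n) * L) / 2 + 3 * L / 4))"
        using n by (simp only: exp_add exp_ln)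
      also have "\<dots> \<le> exp (- sqrt (ln (real n)) + 3 * L / 4)"
        unfolding exp_le_cancel_iff using kL by argo
      finally have 3: "real n * s ^ (2 * k n - 3) \<le> exp (- sqrt (ln (real n))) * exp (3 * L / 4)"
        by (simp only: exp_add)
      have s0: "0 \<le> s" by (simp add: s_exp)
      have y0: "0 \<le> y n + 1" "real (k n) \<le> y n + 1" using elim by linarith+
      have "real (k n) * s ^ (k n - 2)
          \<le> (y n + 1) * (exp (- (ln (real n) + sqrt (ln (real n))) / 2) * exp (L / 2))"
        using y0 2 s0 by (intro mult_mono) auto
      from mult_mono[OF y0(2) add_mono[OF this 3] y0(1)]
      have "real (k n) * (real (k n) * s ^ (k n - 2) + real n * s ^ (2 * k n - 3)) \<le> B n"
        unfolding B_def using s0 by simp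
      with 1 show ?case by (intro add_mono) auto
    qed
    have "(\<lambda>n. exp (- 2 * sqrt (ln (real n)))) \<longlonglongrightarrow> 0" by real_asymp
    moreover have "B \<longlonglongrightarrow> 0"
    proof -
      have "(\<lambda>n. (y n + 1) * ((y n + 1) * exp (- (ln (real n) + sqrt (ln (real n))) / 2))) \<longlonglongrightarrow> 0"
        "(\<lambda>n. (y n + 1) * exp (- sqrt (ln (real n)))) \<longlonglongrightarrow> 0"
        unfolding y_def using L by real_asymp+
      then have "(\<lambda>n. (y n + 1) * ((y n + 1) * exp (- (ln (real n) + sqrt (ln (real n))) / 2)) * exp (L / 2)
          + (y n + 1) * exp (- sqrt (ln (real n))) * exp (3 * L / 4)) \<longlonglongrightarrow> 0 * exp (L / 2) + 0 * exp (3 * L / 4)"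
        by (intro tendsto_intros)
      then show ?thesis by (simp add: B_def[abs_def] algebra_simps)
    qed
    then have "(\<lambda>n. exp (B n) - 1) \<longlonglongrightarrow> exp 0 - 1" by (intro tendsto_intros)
    ultimately show "(\<lambda>n. exp (- 2 * sqrt (ln (real n))) + (exp (B n) - 1)) \<longlonglongrightarrow> 0"
      using tendsto_add by fastforce
  qed simp
qed

theorem theorem3p2:
  fixes p q :: real
  assumes "0 < p" and "p < 1" and "q = 1 - p"
  shows "\<exists>\<epsilon> :: nat \<Rightarrow> real. \<epsilon> \<longlonglongrightarrow> 0 \<and>
    (\<lambda>n. measure_pmf.prob (random_graph n p)
       {G. ereal_of_enat (D 0 G) \<le> ereal ((2 + \<epsilon> n) * (ln (real n) / (- ln (p^2 + q^2))))})
      \<longlonglongrightarrow> 1"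
proof -
  define r s where "r = p\<^sup>2 + (1 - p)\<^sup>2" and "s = sqrt (sqrt r)"
  define L where "L = - ln r"
  define k where "k n = nat \<lceil>(2 * ln (real n) + 2 * sqrt (ln (real n))) / L\<rceil>" for n :: nat
  \<comment> \<open>Chosen so that the claimed bound equals \<open>k n + 2\<close> exactly once
    \<open>ln n\<close> is nonzero, that is from \<open>n = 2\<close> on.\<close>
  define \<epsilon> where "\<epsilon> n = (real (k n) + 2) * L / ln (real n) - 2" for n
  define err where "err n = real (n\<^sup>2) * r ^ k n +
      (exp (real (k n) * (real (k n) * s ^ (k n - 2) + real n * s ^ (2 * k n - 3))) - 1)" for n
  have asym: "\<epsilon> \<longlonglongrightarrow> 0" "\<forall>\<^sub>F n in sequentially. 2 \<le> k n \<and> k n \<le> n" "err \<longlonglongrightarrow> 0"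
    using sieve_size_asymptotics[OF assms(1,2), folded r_def, folded s_def L_def, folded k_def,
        folded \<epsilon>_def err_def]
    by auto
  have "r < 1"
  proof -
    have "r = 1 - 2 * (p * (1 - p))" by (simp add: r_def power2_eq_square algebra_simps)
    moreover have "0 < p * (1 - p)" using assms by simp
    ultimately show ?thesis by linarith
  qed
  moreover have "0 < r" using assms by (simp add: r_def add_pos_pos)
  ultimately have L: "0 < L" by (simp add: L_def)
  let ?S = "\<lambda>n. {G :: nat graph. ereal_of_enat (D 0 G)
      \<le> ereal ((2 + \<epsilon> n) * (ln (real n) / (- ln (p^2 + q^2))))}"
  have "(\<lambda>n. measure_pmf.prob (random_graph n p) (?S n)) \<longlonglongrightarrow> 1"
  proof (rule tendsto_sandwich[where h = "\<lambda>_. 1"])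
    show "\<forall>\<^sub>F n in sequentially. 1 - err n \<le> measure_pmf.prob (random_graph n p) (?S n)"
      using asym(2) eventually_ge_at_top[of 2]
    proof eventually_elim
      case (elim n)
      have "(2 + \<epsilon> n) * (ln (real n) / (- ln (p^2 + q^2))) = real (k n + 2)"
        using elim L assms(3) by (simp add: \<epsilon>_def L_def r_def)
      then have S: "?S n = {G. ereal_of_enat (D 0 G) \<le> ereal_of_enat (enat (k n + 2))}"
        by simp
      then have "?S n = {G. D 0 G \<le> enat (k n + 2)}"
        unfolding S ereal_of_enat_le_iff ..
      then show ?case
        using prob_D_0_le[of "k n" n p] elim assms(1,2) by (simp add: err_def r_def s_def)
    qed
    show "(\<lambda>n. 1 - err n) \<longlonglongrightarrow> 1"
      using tendsto_diff[OF tendsto_const asym(3)] by simp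
  qed simp_all
  with asym(1) show ?thesis by blast
qed

end
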